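(* Let $\mathcal{H}$ be a separable complex Hilbert space and let $A$ be a bounded linear operator on $\mathcal{H}$. If there exists a set of vectors $G \subset \mathcal{H}$ such that the system $\{A^n g\}_{g\in G,\, n\ge 0}$ is a frame in $\mathcal{H}$, then for every $f\in\mathcal{H}$, $(A^* )^n f \to 0$ (in norm) as $n\to\infty$.
   Context: The system $\{A^n g\}_{g\in G,\,n\ge 0}$ is regarded as a family indexed by pairs $(g,n)$ with $g\in G$, $n\in\{0,1,2,\dots\}$. It is a frame in $\mathcal{H}$ if there are constants $0<C_1\le C_2<\infty$ such that $C_1\|f\|^2\le \sum_{g\in G}\sum_{n=0}^\infty |\langle f, A^n g\rangle|^2\le C_2\|f\|^2$ for all $f\in\mathcal{H}$. $A^*$ denotes the adjoint of $A$. *)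

theory Defs
  imports "HOL-Analysis.Analysis"
begin

section \<open>Complex Hilbert spaces\<close>

text \<open>
  A complex inner product space is built on top of the library class of real inner product
  spaces: the real inner product is the real part of the complex one, so that norm and topology
  are the library ones, and lemma \<open>cinner_self\<close> below recovers the usual
  \<open>\<langle>x, x\<rangle> = \<parallel>x\<parallel>\<^sup>2\<close>. The complex inner product is linear in its first argument and
  conjugate-linear in the second.
\<close>

class complex_inner = real_inner +
  fixes scaleC :: "complex \<Rightarrow> 'a \<Rightarrow> 'a"
    and cinner :: "'a \<Rightarrow> 'a \<Rightarrow> complex"
  assumes scaleC_add_right: "scaleC a (x + y) = scaleC a x + scaleC a y"
    and scaleC_add_left: "scaleC (a + b) x = scaleC a x + scaleC b x"
    and scaleC_scaleC: "scaleC a (scaleC b x) = scaleC (a * b) x"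
    and scaleC_complex_of_real: "scaleC (complex_of_real r) x = r *\<^sub>R x"
    and cinner_commute: "cinner x y = cnj (cinner y x)"
    and cinner_add_left: "cinner (x + y) z = cinner x z + cinner y z"
    and cinner_scaleC_left: "cinner (scaleC a x) y = a * cinner x y"
    and Re_cinner: "Re (cinner x y) = inner x y"

class complex_hilbert_space = complex_inner + complete_space

lemma cinner_self:
  fixes x :: "'a::complex_inner"
  shows "cinner x x = complex_of_real ((norm x)\<^sup>2)"
proof -
  have "Im (cinner x x) = 0"
    using arg_cong[OF cinner_commute[of x x], of Im] by simp
  then show ?thesis
    by (simp add: complex_eq_iff Re_cinner power2_norm_eq_inner)
qed

instantiation complex :: complex_hilbert_space
begin

definition scaleC_complex :: "complex \<Rightarrow> complex \<Rightarrow> complex"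
  where "scaleC_complex a x = a * x"

definition cinner_complex :: "complex \<Rightarrow> complex \<Rightarrow> complex"
  where "cinner_complex x y = x * cnj y"

instance
proof
  fix a b x y z :: complex and r :: real
  show "scaleC a (x + y) = scaleC a x + scaleC a y"
    by (simp add: scaleC_complex_def distrib_left)
  show "scaleC (a + b) x = scaleC a x + scaleC b x"
    by (simp add: scaleC_complex_def distrib_right)
  show "scaleC a (scaleC b x) = scaleC (a * b) x"
    by (simp add: scaleC_complex_def)
  show "scaleC (complex_of_real r) x = r *\<^sub>R x"
    by (simp add: scaleC_complex_def scaleR_conv_of_real)
  show "cinner x y = cnj (cinner y x)"
    by (simp add: cinner_complex_def)
  show "cinner (x + y) z = cinner x z + cinner y z"
    by (simp add: cinner_complex_def distrib_right)
  show "cinner (scaleC a x) y = a * cinner x y"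
    by (simp add: cinner_complex_def scaleC_complex_def)
  show "Re (cinner x y) = inner x y"
    by (simp add: cinner_complex_def inner_complex_def)
qed

end


section \<open>Bounded operators and adjoints\<close>

definition bounded_clinear :: "('a::complex_inner \<Rightarrow> 'b::complex_inner) \<Rightarrow> bool"
  where "bounded_clinear A \<longleftrightarrow> bounded_linear A \<and> (\<forall>c x. A (scaleC c x) = scaleC c (A x))"

definition cadjoint :: "('a::complex_inner \<Rightarrow> 'a) \<Rightarrow> 'a \<Rightarrow> 'a"
  where "cadjoint A = (THE B. \<forall>x y. cinner (A x) y = cinner x (B y))"

text \<open>
  The description in \<open>cadjoint_def\<close> is well-defined for bounded operators on a Hilbert space:
  existence comes from the Riesz representation theorem.
\<close>

lemma riesz_real:
  fixes \<phi> :: "'a::{real_inner, complete_space} \<Rightarrow> real"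
  assumes "bounded_linear \<phi>"
  shows "\<exists>z. \<forall>x. \<phi> x = inner x z"
proof -
  note add = linear_add[OF bounded_linear.linear[OF assms]]
    and scaleR = linear_scale[OF bounded_linear.linear[OF assms]]
    and zero = linear_0[OF bounded_linear.linear[OF assms]]
  define J where "J = (\<lambda>x. (norm x)\<^sup>2 / 2 - \<phi> x)"
  define m where "m = (INF x. J x)"
  obtain K where K: "\<And>x. norm (\<phi> x) \<le> norm x * K"
    using bounded_linear.bounded[OF assms] by blast
  have lower: "- (K\<^sup>2 / 2) \<le> J x" for x
  proof -
    have "\<phi> x \<le> norm x * K" using K[of x] by simp
    moreover have "0 \<le> (norm x - K)\<^sup>2" by simp
    ultimately show ?thesis unfolding J_def by (simp add: power2_diff)
  qed
  have bdd: "bdd_below (range J)"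
    unfolding bdd_below_def using lower by blast
  have m_le: "m \<le> J x" for x
    unfolding m_def using bdd by (auto intro: cINF_lower)
  have "\<exists>x. J x < m + inverse (real (Suc n))" for n
  proof (rule ccontr)
    assume "\<nexists>x. J x < m + inverse (real (Suc n))"
    then have "m + inverse (real (Suc n)) \<le> m"
      unfolding m_def by (intro cINF_greatest) (auto simp: not_less)
    then show False by simp
  qed
  then obtain X where X: "\<And>n. J (X n) < m + inverse (real (Suc n))"
    by metis
  have par: "(norm (x - y))\<^sup>2 \<le> 4 * (J x - m) + 4 * (J y - m)" for x y
  proof -
    define c where "c = (1/2) *\<^sub>R (x + y)"
    have "(norm (x - y))\<^sup>2 = 4 * J x + 4 * J y - 8 * J c"
      unfolding J_def c_def power2_norm_eq_inner
      by (simp add: scaleR add inner_add_left inner_add_right inner_diff_left inner_diff_right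
          inner_commute[of y x] field_simps)
    then show ?thesis using m_le[of c] by (simp add: algebra_simps)
  qed
  have "Cauchy X"
  proof (rule metric_CauchyI)
    fix e :: real assume "0 < e"
    then obtain N where N: "inverse (real (Suc N)) < e\<^sup>2 / 8"
      using reals_Archimedean[of "e\<^sup>2 / 8"] by auto
    have "dist (X i) (X j) < e" if "i \<ge> N" "j \<ge> N" for i j
    proof -
      have near: "J (X k) - m < e\<^sup>2 / 8" if "k \<ge> N" for k
      proof -
        have "inverse (real (Suc k)) \<le> inverse (real (Suc N))"
          using that by (simp add: field_simps)
        then show ?thesis using X[of k] N by linarith
      qed
      from near[OF \<open>i \<ge> N\<close>] near[OF \<open>j \<ge> N\<close>] par[of "X i" "X j"] have "(norm (X i - X j))\<^sup>2 < e\<^sup>2"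
        by (simp add: algebra_simps)
      then show ?thesis using \<open>0 < e\<close> by (simp add: dist_norm power2_less_imp_less)
    qed
    then show "\<exists>M. \<forall>i\<ge>M. \<forall>j\<ge>M. dist (X i) (X j) < e" by blast
  qed
  then obtain z where z: "X \<longlonglongrightarrow> z"
    using Cauchy_convergent convergent_def by blast
  have "(\<lambda>n. J (X n)) \<longlonglongrightarrow> J z"
    unfolding J_def by (intro tendsto_intros bounded_linear.tendsto[OF assms] z) auto
  moreover have "(\<lambda>n. m + inverse (real (Suc n))) \<longlonglongrightarrow> m + 0"
    by (intro tendsto_intros LIMSEQ_inverse_real_of_nat)
  ultimately have "J z \<le> m + 0"
    by (rule LIMSEQ_le) (use X less_imp_le in blast)
  then have min: "J z \<le> J x" for x
    using m_le[of x] by simp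
  have "\<phi> h = inner h z" for h
  proof (rule ccontr)
    define d where "d = inner h z - \<phi> h"
    assume "\<phi> h \<noteq> inner h z"
    then have "d \<noteq> 0" by (simp add: d_def)
    then have "h \<noteq> 0" by (auto simp: d_def zero)
    define n where "n = (norm h)\<^sup>2"
    have "n > 0" using \<open>h \<noteq> 0\<close> by (simp add: n_def)
    have expand: "J (z + t *\<^sub>R h) = J z + t * d + t\<^sup>2 * n / 2" for t :: real
      unfolding J_def d_def n_def power2_norm_eq_inner
      by (simp add: scaleR add inner_add_left inner_add_right inner_commute[of z h] field_simps
          power2_eq_square)
    have "0 \<le> (- d / n) * d + (- d / n)\<^sup>2 * n / 2"
      using min[of "z + (- d / n) *\<^sub>R h"] unfolding expand by linarith
    also have "\<dots> = - (d\<^sup>2 / (2 * n))"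
      using \<open>n > 0\<close> by (simp add: field_simps power2_eq_square)
    also have "\<dots> < 0"
      using \<open>n > 0\<close> \<open>d \<noteq> 0\<close> by simp
    finally show False by simp
  qed
  then show ?thesis by blast
qed

lemma cinner_eqI:
  fixes u v :: "'a::complex_inner"
  assumes "\<And>x. cinner x u = cinner x v"
  shows "u = v"
proof -
  have "inner (u - v) u = inner (u - v) v"
    using assms[of "u - v"] by (metis Re_cinner)
  then have "inner (u - v) (u - v) = 0" by (simp add: inner_diff_right)
  then show ?thesis by simp
qed

lemma Im_cinner:
  fixes x y :: "'a::complex_inner"
  shows "Im (cinner x y) = - inner (scaleC \<i> x) y"
  by (simp add: Re_cinner[symmetric] cinner_scaleC_left)

lemma cadjoint_exists_unique:
  fixes A :: "'a::complex_hilbert_space \<Rightarrow> 'a"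
  assumes "bounded_clinear A"
  shows "\<exists>!B. \<forall>x y. cinner (A x) y = cinner x (B y)"
proof (rule ex_ex1I)
  have bl: "bounded_linear A" and sc: "\<And>c x. A (scaleC c x) = scaleC c (A x)"
    using assms by (auto simp: bounded_clinear_def)
  have "\<exists>z. \<forall>x. inner (A x) y = inner x z" for y
    using riesz_real[OF bounded_linear_compose[OF bounded_linear_inner_left bl, of y]] by simp
  then obtain B where B: "\<And>x y. inner (A x) y = inner x (B y)"
    by metis
  have "cinner (A x) y = cinner x (B y)" for x y
    by (simp add: complex_eq_iff Re_cinner Im_cinner B sc[symmetric])
  then show "\<exists>B. \<forall>x y. cinner (A x) y = cinner x (B y)" by blast
next
  fix B C :: "'a \<Rightarrow> 'a"
  assume "\<forall>x y. cinner (A x) y = cinner x (B y)" "\<forall>x y. cinner (A x) y = cinner x (C y)"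
  then have "cinner x (B y) = cinner x (C y)" for x y by metis
  then show "B = C" using cinner_eqI by blast
qed

lemma cinner_cadjoint:
  fixes A :: "'a::complex_hilbert_space \<Rightarrow> 'a"
  assumes "bounded_clinear A"
  shows "cinner (A x) y = cinner x (cadjoint A y)"
  using theI'[OF cadjoint_exists_unique[OF assms]] unfolding cadjoint_def by blast


section \<open>Frames\<close>

text \<open>
  Summability is required explicitly, since \<open>infsum\<close> is \<open>0\<close> on non-summable families. No
  countability of the index set is assumed.
\<close>

definition is_frame :: "'i set \<Rightarrow> ('i \<Rightarrow> 'a::complex_inner) \<Rightarrow> bool"
  where "is_frame I x \<longleftrightarrow>
    (\<exists>C1 C2 :: real. 0 < C1 \<and> C1 \<le> C2 \<and>
      (\<forall>f. (\<lambda>i. (cmod (cinner f (x i)))\<^sup>2) summable_on I \<and>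
        C1 * (norm f)\<^sup>2 \<le> (\<Sum>\<^sub>\<infinity>i\<in>I. (cmod (cinner f (x i)))\<^sup>2) \<and>
        (\<Sum>\<^sub>\<infinity>i\<in>I. (cmod (cinner f (x i)))\<^sup>2) \<le> C2 * (norm f)\<^sup>2))"

end

theory Submission
  imports Defs
begin

text \<open>
  Write \<open>B\<close> for the adjoint of \<open>A\<close>. Moving \<open>B\<^sup>m\<close> across the inner product turns the frame
  coefficient of \<open>B\<^sup>m f\<close> at \<open>(g, n)\<close> into \<open>\<langle>f, A\<^sup>n\<^sup>+\<^sup>m g\<rangle>\<close>, which is the coefficient of \<open>f\<close>
  itself at \<open>(g, n + m)\<close>. So replacing \<open>f\<close> by \<open>B\<^sup>m f\<close> only discards the coefficients of \<open>f\<close>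
  at levels below \<open>m\<close> (lemma \<open>frame_coefficients_cadjoint_funpow\<close>). The coefficients of \<open>f\<close>
  are square-summable, so what remains, the tail over levels at least \<open>m\<close>, tends to \<open>0\<close>
  (lemma \<open>infsum_tail_tendsto_0\<close>). By the lower frame bound this tail dominates a fixed
  positive multiple of \<open>\<parallel>B\<^sup>m f\<parallel>\<^sup>2\<close>.
\<close>

text \<open>
  Up to \<open>e\<close>, the whole sum is carried by a finite set \<open>S\<close>. The level \<open>h\<close> is bounded on \<open>S\<close>,
  so a late enough tail avoids \<open>S\<close>. This works even when every single level is infinite.
\<close>

lemma infsum_tail_tendsto_0:
  fixes F :: "'i \<Rightarrow> real" and h :: "'i \<Rightarrow> nat"
  assumes summable: "F summable_on I" and nonneg: "\<And>i. i \<in> I \<Longrightarrow> 0 \<le> F i"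
  shows "(\<lambda>m. \<Sum>\<^sub>\<infinity>i\<in>{i\<in>I. m \<le> h i}. F i) \<longlonglongrightarrow> 0"
proof (rule LIMSEQ_I)
  fix e :: real assume "0 < e"
  obtain S where S: "finite S" "S \<subseteq> I" and close: "dist (sum F S) (infsum F I) \<le> e / 2"
    using infsum_finite_approximation[OF summable, of "e / 2"] \<open>0 < e\<close> by auto
  obtain N where N: "\<And>i. i \<in> S \<Longrightarrow> h i < N"
    using finite_nat_set_iff_bounded[of "h ` S"] S(1) by auto
  have "norm ((\<Sum>\<^sub>\<infinity>i\<in>{i\<in>I. m \<le> h i}. F i) - 0) < e" if "N \<le> m" for m
  proof -
    let ?T = "{i\<in>I. m \<le> h i}"
    have "infsum F ?T \<le> infsum F (I - S)"
    proof (rule infsum_mono_neutral)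
      show "F summable_on ?T" "F summable_on (I - S)"
        by (rule summable_on_subset_banach[OF summable]; blast)+
      show "F i \<le> 0" if "i \<in> ?T - (I - S)" for i
        using that N[of i] \<open>N \<le> m\<close> by auto
    qed (use nonneg in auto)
    also have "\<dots> = infsum F I - sum F S"
      using infsum_Diff[OF summable _ S(2)] S(1) by simp
    also have "\<dots> < e"
      using close \<open>0 < e\<close> unfolding dist_real_def by linarith
    finally show ?thesis
      using infsum_nonneg[of ?T F] nonneg by simp
  qed
  then show "\<exists>N. \<forall>m\<ge>N. norm ((\<Sum>\<^sub>\<infinity>i\<in>{i\<in>I. m \<le> h i}. F i) - 0) < e" by blast
qed

lemma cinner_cadjoint_funpow:
  fixes A :: "'a::complex_hilbert_space \<Rightarrow> 'a"
  assumes "bounded_clinear A"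
  shows "cinner ((cadjoint A ^^ m) f) v = cinner f ((A ^^ m) v)"
proof (induction m arbitrary: v)
  case (Suc m)
  have "cinner (cadjoint A x) v = cinner x (A v)" for x
    using cinner_cadjoint[OF assms, of v x] cinner_commute by metis
  then show ?case
    by (simp add: Suc.IH funpow_swap1[of A m v])
qed simp

text \<open>
  The shift \<open>n \<mapsto> n + m\<close> identifies all pairs \<open>(g, n)\<close> with the pairs of level at least \<open>m\<close>.
\<close>

lemma frame_coefficients_cadjoint_funpow:
  fixes A :: "'a::complex_hilbert_space \<Rightarrow> 'a"
  assumes "bounded_clinear A"
  shows "(\<Sum>\<^sub>\<infinity>(g, n)\<in>G \<times> UNIV. (cmod (cinner ((cadjoint A ^^ m) f) ((A ^^ n) g)))\<^sup>2) =
    (\<Sum>\<^sub>\<infinity>(g, n)\<in>{p \<in> G \<times> UNIV. m \<le> snd p}. (cmod (cinner f ((A ^^ n) g)))\<^sup>2)"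
  by (rule infsum_reindex_bij_witness[where i = "\<lambda>(g, n). (g, n - m)" and j = "\<lambda>(g, n). (g, n + m)"])
    (auto simp: cinner_cadjoint_funpow[OF assms] add.commute[of _ m] funpow_add)

theorem theorem7:
  fixes A :: "'a::complex_hilbert_space \<Rightarrow> 'a"
  assumes "separable_space (euclidean :: 'a topology)"
    and "bounded_clinear A"
    and "\<exists>G :: 'a set. is_frame (G \<times> (UNIV :: nat set)) (\<lambda>(g, n). (A ^^ n) g)"
  shows "\<forall>f. (\<lambda>n. (cadjoint A ^^ n) f) \<longlonglongrightarrow> 0"
proof
  fix f :: 'a
  let ?B = "cadjoint A"
  define c where "c = (\<lambda>f (g, n). (cmod (cinner f ((A ^^ n) g)))\<^sup>2)"
  have c_eq: "c f = (\<lambda>p. (cmod (cinner f (case p of (g, n) \<Rightarrow> (A ^^ n) g)))\<^sup>2)" for f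
    by (auto simp: c_def)
  obtain G :: "'a set" and C where "0 < C"
    and summable: "\<And>f. c f summable_on G \<times> UNIV"
    and lower: "\<And>f. C * (norm f)\<^sup>2 \<le> infsum (c f) (G \<times> UNIV)"
    using assms(3) unfolding is_frame_def c_eq by blast
  define tail where "tail = (\<lambda>m. infsum (c f) {p \<in> G \<times> UNIV. m \<le> snd p})"
  have "tail \<longlonglongrightarrow> 0"
    unfolding tail_def by (rule infsum_tail_tendsto_0[OF summable]) (auto simp: c_def)
  then have "(\<lambda>m. sqrt (tail m / C)) \<longlonglongrightarrow> 0"
    using tendsto_real_sqrt[OF tendsto_divide[OF _ tendsto_const[of C]]] \<open>0 < C\<close> by fastforce
  moreover have "norm ((?B ^^ m) f) \<le> sqrt (tail m / C)" for m
  proof (rule real_le_rsqrt)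
    have "C * (norm ((?B ^^ m) f))\<^sup>2 \<le> tail m"
      using lower[of "(?B ^^ m) f"] frame_coefficients_cadjoint_funpow[OF assms(2)]
      by (simp add: tail_def c_def)
    then show "(norm ((?B ^^ m) f))\<^sup>2 \<le> tail m / C"
      using \<open>0 < C\<close> by (simp add: field_simps)
  qed
  ultimately show "(\<lambda>m. (?B ^^ m) f) \<longlonglongrightarrow> 0"
    by (rule Lim_null_comparison[OF always_eventually[OF allI], rotated])
qed

end
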